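(* Let $\mathcal{H}$ be a complex Hilbert space, let $T$ be an $EP$ operator on $\mathcal{H}$ and let $A\in\mathcal{B}(\mathcal{H})$. If $AT=TA$, then $AT^\dagger=T^\dagger A$.
   Context: $\mathcal{B}(\mathcal{H})$ is the space of bounded linear operators on $\mathcal{H}$; $\mathcal{R}(T)$ denotes the range of $T$ and $T^*$ its adjoint. For $T\in\mathcal{B}(\mathcal{H})$ with closed range, the Moore-Penrose inverse $T^\dagger$ is the unique operator in $\mathcal{B}(\mathcal{H})$ satisfying $TT^\dagger T=T$, $T^\dagger TT^\dagger=T^\dagger$, $TT^\dagger=(TT^\dagger)^*$ and $T^\dagger T=(T^\dagger T)^*$. An $EP$ operator on $\mathcal{H}$ is a $T\in\mathcal{B}(\mathcal{H})$ with closed range such that $\mathcal{R}(T)=\mathcal{R}(T^* )$. *)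

theory Defs
  imports "HOL-Analysis.Analysis"
begin

class scaleC =
  fixes scaleC :: "complex \<Rightarrow> 'a \<Rightarrow> 'a"  (infixr \<open>*\<^sub>C\<close> 75)

class complex_vector = scaleC + real_vector +
  assumes scaleC_add_right: "a *\<^sub>C (x + y) = a *\<^sub>C x + a *\<^sub>C y"
    and scaleC_add_left: "(a + b) *\<^sub>C x = a *\<^sub>C x + b *\<^sub>C x"
    and scaleC_scaleC: "a *\<^sub>C b *\<^sub>C x = (a * b) *\<^sub>C x"
    and scaleC_one: "1 *\<^sub>C x = x"
    and scaleR_scaleC: "r *\<^sub>R x = complex_of_real r *\<^sub>C x"

text \<open>The inner product is linear in its first argument and conjugate-linear in its second.
  Positivity is the conjunction of \<open>cinner_real\<close>, \<open>cinner_ge_zero\<close> and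
  \<open>cinner_eq_zero_iff\<close>.\<close>

class complex_inner = complex_vector + real_normed_vector +
  fixes cinner :: "'a \<Rightarrow> 'a \<Rightarrow> complex"
  assumes cinner_commute: "cinner x y = cnj (cinner y x)"
    and cinner_add_left: "cinner (x + y) z = cinner x z + cinner y z"
    and cinner_scaleC_left: "cinner (a *\<^sub>C x) y = a * cinner x y"
    and cinner_real: "Im (cinner x x) = 0"
    and cinner_ge_zero: "0 \<le> Re (cinner x x)"
    and cinner_eq_zero_iff: "cinner x x = 0 \<longleftrightarrow> x = 0"
    and norm_eq_sqrt_cinner: "norm x = sqrt (Re (cinner x x))"

class chilbert_space = complex_inner + complete_space

instantiation complex :: chilbert_space
begin

definition scaleC_complex :: "complex \<Rightarrow> complex \<Rightarrow> complex"
  where "scaleC_complex a x = a * x"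

definition cinner_complex :: "complex \<Rightarrow> complex \<Rightarrow> complex"
  where "cinner_complex x y = x * cnj y"

instance
  by standard
    (auto simp: scaleC_complex_def cinner_complex_def algebra_simps scaleR_conv_of_real
      cmod_def power2_eq_square)

end

definition bounded_clinear ::
  "('a::{complex_vector, real_normed_vector} \<Rightarrow> 'b::{complex_vector, real_normed_vector}) \<Rightarrow> bool"
  where "bounded_clinear f \<longleftrightarrow> bounded_linear f \<and> (\<forall>c x. f (c *\<^sub>C x) = c *\<^sub>C f x)"

text \<open>The description in \<open>cadjoint\<close> is proper for bounded operators on a Hilbert space, by
  the Riesz representation theorem; the one in \<open>moore_penrose\<close> is proper for bounded
  operators with closed range.\<close>

definition cadjoint :: "('a::chilbert_space \<Rightarrow> 'a) \<Rightarrow> 'a \<Rightarrow> 'a"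
  where "cadjoint T =
    (THE S. bounded_clinear S \<and> (\<forall>x y. cinner (T x) y = cinner x (S y)))"

definition moore_penrose :: "('a::chilbert_space \<Rightarrow> 'a) \<Rightarrow> 'a \<Rightarrow> 'a"
  where "moore_penrose T =
    (THE S. bounded_clinear S \<and>
      T \<circ> S \<circ> T = T \<and> S \<circ> T \<circ> S = S \<and>
      T \<circ> S = cadjoint (T \<circ> S) \<and> S \<circ> T = cadjoint (S \<circ> T))"

definition EP_operator :: "('a::chilbert_space \<Rightarrow> 'a) \<Rightarrow> bool"
  where "EP_operator T \<longleftrightarrow>
    bounded_clinear T \<and> closed (range T) \<and> range T = range (cadjoint T)"

end

theory Submission
  imports Defs
begin

text \<open>An \<open>EP\<close> operator \<open>T\<close> commutes with its Moore-Penrose inverse \<open>S\<close>, and this turns the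
  statement into semigroup algebra. The equations \<open>TST = T\<close>, \<open>STS = S\<close> and \<open>TS = ST\<close> give
  \<open>S = TSS = SST\<close>, and for \<open>A\<close> commuting with \<open>T\<close> both \<open>AS = A(TSS)\<close> and \<open>SA = (SST)A\<close> can be
  rewritten to \<open>TSAS\<close> (lemma \<open>commutes_with_group_inverse\<close>).

  The analytic content is that \<open>S\<close> exists as a bounded operator and commutes with \<open>T\<close>. Since
  \<open>T\<close> and \<open>T\<^sup>*\<close> have the same closed range \<open>R\<close>, both of them vanish on the orthogonal complement
  of \<open>R\<close> and map \<open>R\<close> bijectively onto itself. Inverting them on \<open>R\<close>, after
  projecting orthogonally onto \<open>R\<close>, gives maps \<open>S\<close> and \<open>S'\<close> that are formally adjoint to each
  other. Any everywhere defined map with a formal adjoint is linear, and it is bounded by the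
  Hellinger-Toeplitz argument, an application of uniform boundedness. Both \<open>TS\<close> and \<open>ST\<close> are
  the orthogonal projection onto \<open>R\<close>, so \<open>S\<close> is the Moore-Penrose inverse.

  The definitions of the adjoint and of the Moore-Penrose inverse are descriptions, so they say
  something only once existence and uniqueness are known. For the adjoint, existence rests on
  the projection theorem and the Riesz representation theorem.\<close>

section \<open>Inner product geometry\<close>

lemma scaleC_minus_one: "(- 1) *\<^sub>C x = - (x :: 'a::complex_vector)"
  using scaleR_scaleC[of "-1" x] by simp

lemma scaleC_zero_right: "a *\<^sub>C 0 = (0 :: 'a::complex_vector)"
  using scaleC_add_right[of a 0 "0::'a"] by simp

lemma cinner_scaleC_right:
  "cinner x (a *\<^sub>C y) = cnj a * cinner (x :: 'a::complex_inner) y"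
  by (metis cinner_commute cinner_scaleC_left complex_cnj_mult)

lemma cinner_add_right:
  "cinner (x :: 'a::complex_inner) (y + z) = cinner x y + cinner x z"
  by (metis cinner_commute cinner_add_left complex_cnj_add)

lemma cinner_minus_left: "cinner (- x) y = - cinner (x :: 'a::complex_inner) y"
  using cinner_scaleC_left[of "-1" x y] by (simp add: scaleC_minus_one)

lemma cinner_minus_right: "cinner x (- y) = - cinner (x :: 'a::complex_inner) y"
  using cinner_scaleC_right[of x "-1" y] by (simp add: scaleC_minus_one)

lemma cinner_diff_left:
  "cinner (x - y) z = cinner (x :: 'a::complex_inner) z - cinner y z"
  using cinner_add_left[of x "-y" z] by (simp add: cinner_minus_left)

lemma cinner_diff_right:
  "cinner x (y - z) = cinner (x :: 'a::complex_inner) y - cinner x z"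
  using cinner_add_right[of x y "-z"] by (simp add: cinner_minus_right)

lemma cinner_zero_left [simp]: "cinner 0 (y :: 'a::complex_inner) = 0"
  using cinner_diff_left[of 0 0 y] by simp

lemma cinner_zero_right [simp]: "cinner (x :: 'a::complex_inner) 0 = 0"
  using cinner_diff_right[of x 0 0] by simp

lemma cinner_eq_zero_commute: "cinner x y = 0 \<longleftrightarrow> cinner y (x :: 'a::complex_inner) = 0"
  by (metis cinner_commute complex_cnj_zero)

lemma cinner_self: "cinner x x = complex_of_real ((norm (x :: 'a::complex_inner))\<^sup>2)"
  by (simp add: norm_eq_sqrt_cinner cinner_ge_zero complex_eq_iff cinner_real)

lemma cinner_left_ext:
  assumes "\<And>z. cinner (x :: 'a::complex_inner) z = cinner y z"
  shows "x = y"
  using assms[of "x - y"] cinner_eq_zero_iff[of "x - y"] by (simp add: cinner_diff_left)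

lemma cinner_right_ext:
  assumes "\<And>z. cinner z (x :: 'a::complex_inner) = cinner z y"
  shows "x = y"
  using assms[of "x - y"] cinner_eq_zero_iff[of "x - y"] by (simp add: cinner_diff_right)

lemma parallelogram_law:
  fixes x y :: "'a::complex_inner"
  shows "(norm (x + y))\<^sup>2 + (norm (x - y))\<^sup>2 = 2 * (norm x)\<^sup>2 + 2 * (norm y)\<^sup>2"
proof -
  have "complex_of_real ((norm (x + y))\<^sup>2 + (norm (x - y))\<^sup>2)
      = complex_of_real (2 * (norm x)\<^sup>2 + 2 * (norm y)\<^sup>2)"
    unfolding of_real_add of_real_mult cinner_self[symmetric]
    by (simp add: cinner_add_left cinner_add_right cinner_diff_left cinner_diff_right)
  then show ?thesis
    using of_real_eq_iff by blast
qed

text \<open>Subtracting from \<open>x\<close> its component along \<open>y\<close> shortens it by a definite amount. The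
  Cauchy-Schwarz inequality follows because the left-hand side is nonnegative, and the
  orthogonality of the shortest vector in the projection theorem because it cannot be
  shortened.\<close>

lemma norm_diff_component:
  fixes x y :: "'a::complex_inner"
  assumes "y \<noteq> 0"
  shows "(norm (x - (cinner x y / cinner y y) *\<^sub>C y))\<^sup>2
    = (norm x)\<^sup>2 - (cmod (cinner x y))\<^sup>2 / (norm y)\<^sup>2"
proof -
  have nz: "cinner y y \<noteq> 0"
    using assms cinner_eq_zero_iff by blast
  have real: "cnj (cinner y y) = cinner y y"
    using cinner_commute[of y y] by simp
  have yx: "cinner y x = cnj (cinner x y)"
    by (rule cinner_commute)
  have "complex_of_real ((norm (x - (cinner x y / cinner y y) *\<^sub>C y))\<^sup>2)
      = cinner x x - cinner x y * cnj (cinner x y) / cinner y y"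
    unfolding cinner_self[symmetric] using nz
    by (simp add: cinner_diff_left cinner_diff_right
        cinner_scaleC_left cinner_scaleC_right real yx)
  also have "\<dots> = complex_of_real ((norm x)\<^sup>2 - (cmod (cinner x y))\<^sup>2 / (norm y)\<^sup>2)"
    by (simp add: cinner_self complex_norm_square[symmetric] del: of_real_power)
  finally show ?thesis
    using of_real_eq_iff by blast
qed

lemma cinner_Cauchy_Schwarz:
  "cmod (cinner x y) \<le> norm x * norm (y :: 'a::complex_inner)"
proof (cases "y = 0")
  case False
  then have "(cmod (cinner x y))\<^sup>2 / (norm y)\<^sup>2 \<le> (norm x)\<^sup>2"
    using norm_diff_component[OF False, of x]
    by (metis diff_ge_0_iff_ge zero_le_power2)
  then have "(cmod (cinner x y))\<^sup>2 \<le> (norm x * norm y)\<^sup>2"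
    using False by (simp add: divide_le_eq power_mult_distrib)
  then show ?thesis
    by (rule power2_le_imp_le) simp
qed simp

lemma bounded_linear_cinner_left: "bounded_linear (\<lambda>x :: 'a::complex_inner. cinner x y)"
  by (rule bounded_linear_intro[where K = "norm y"])
    (simp_all add: cinner_add_left scaleR_scaleC[where ?'a = 'a] cinner_scaleC_left
      cinner_Cauchy_Schwarz scaleR_conv_of_real)

section \<open>Orthogonal projection and Riesz representation\<close>

definition csubspace :: "'a::complex_vector set \<Rightarrow> bool"
  where "csubspace S \<longleftrightarrow> 0 \<in> S \<and> (\<forall>x\<in>S. \<forall>y\<in>S. x + y \<in> S) \<and> (\<forall>c. \<forall>x\<in>S. c *\<^sub>C x \<in> S)"

lemma csubspace_diff:
  assumes "csubspace S" "x \<in> S" "y \<in> S"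
  shows "x - y \<in> S"
proof -
  have "x + (-1) *\<^sub>C y \<in> S"
    using assms unfolding csubspace_def by blast
  then show ?thesis
    by (simp add: scaleC_minus_one)
qed

text \<open>By the parallelogram law, two points of \<open>S\<close> that are nearly closest to \<open>x\<close> are close to
  each other, because their midpoint cannot be nearer to \<open>x\<close> than the infimum. A minimizing
  sequence is therefore Cauchy.\<close>

lemma closest_point_csubspace:
  fixes S :: "'a::chilbert_space set"
  assumes S: "csubspace S" "closed S"
  obtains p where "p \<in> S" "\<And>r. r \<in> S \<Longrightarrow> norm (x - p) \<le> norm (x - r)"
proof -
  define d where "d = infdist x S"
  have ne: "S \<noteq> {}"
    using S(1) by (auto simp: csubspace_def)
  have d_le: "d \<le> norm (x - r)" if "r \<in> S" for r
    using infdist_le[OF that, of x] by (simp add: d_def dist_norm)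
  have d0: "0 \<le> d"
    by (simp add: d_def infdist_nonneg)
  have "\<exists>r\<in>S. (norm (x - r))\<^sup>2 < d\<^sup>2 + 1 / real (Suc n)" for n
  proof -
    have "d < sqrt (d\<^sup>2 + 1 / real (Suc n))"
      by (rule real_less_rsqrt) simp
    then have "(INF r\<in>S. dist x r) < sqrt (d\<^sup>2 + 1 / real (Suc n))"
      using ne by (simp add: d_def infdist_notempty)
    then obtain r where "r \<in> S" "dist x r < sqrt (d\<^sup>2 + 1 / real (Suc n))"
      using cINF_less_iff[OF ne, of "dist x"] by (auto intro: bdd_belowI2[where m = 0])
    then have "(norm (x - r))\<^sup>2 < d\<^sup>2 + 1 / real (Suc n)"
      using power_strict_mono[of "norm (x - r)" "sqrt (d\<^sup>2 + 1 / real (Suc n))" 2]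
      by (simp add: dist_norm)
    with \<open>r \<in> S\<close> show ?thesis
      by blast
  qed
  then obtain r where rS: "\<And>n. r n \<in> S"
    and r: "\<And>n. (norm (x - r n))\<^sup>2 < d\<^sup>2 + 1 / real (Suc n)"
    by metis
  have near: "(norm (r m - r n))\<^sup>2 \<le> 2 / real (Suc m) + 2 / real (Suc n)" for m n
  proof -
    have mid: "(1/2) *\<^sub>C (r m + r n) \<in> S"
      using S(1) rS unfolding csubspace_def by blast
    have half: "(1/2) *\<^sub>C z = (1/2) *\<^sub>R z" for z :: 'a
      by (simp add: scaleR_scaleC)
    have eq: "(x - r m) + (x - r n) = 2 *\<^sub>R (x - (1/2) *\<^sub>R (r m + r n))"
      by (simp add: algebra_simps scaleR_2)
    have "d \<le> norm (x - (1/2) *\<^sub>R (r m + r n))"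
      using d_le[OF mid] by (simp only: half)
    then have "2 * d \<le> norm ((x - r m) + (x - r n))"
      unfolding eq by simp
    then have "(2 * d)\<^sup>2 \<le> (norm ((x - r m) + (x - r n)))\<^sup>2"
      using d0 by (intro power_mono) auto
    moreover have "(x - r m) - (x - r n) = r n - r m"
      by simp
    ultimately show ?thesis
      using parallelogram_law[of "x - r m" "x - r n"] r[of m] r[of n]
      by (simp add: norm_minus_commute power_mult_distrib)
  qed
  have "Cauchy r"
  proof (rule metric_CauchyI)
    fix e :: real
    assume e: "0 < e"
    obtain N where N: "4 / e\<^sup>2 < real N"
      using reals_Archimedean2 by blast
    have "0 < 4 / e\<^sup>2"
      using e by simp
    then have N0: "0 < real N"
      using N by linarith
    have Ne: "4 / real N < e\<^sup>2"
      using N N0 e by (simp add: field_simps)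
    have "dist (r m) (r n) < e" if "m \<ge> N" "n \<ge> N" for m n
    proof -
      have "2 / real (Suc k) \<le> 2 / real N" if "k \<ge> N" for k
        using that N0 by (intro divide_left_mono) auto
      then have "(norm (r m - r n))\<^sup>2 < e\<^sup>2"
        using near[of m n] Ne that by (smt (verit) add_divide_distrib)
      then show ?thesis
        using e by (simp add: dist_norm power_less_imp_less_base)
    qed
    then show "\<exists>M. \<forall>m\<ge>M. \<forall>n\<ge>M. dist (r m) (r n) < e"
      by blast
  qed
  then obtain p where p: "r \<longlonglongrightarrow> p"
    using Cauchy_convergent convergent_def by blast
  have pS: "p \<in> S"
    using closed_sequentially[OF S(2) _ p] rS by blast
  have "(\<lambda>n. (norm (x - r n))\<^sup>2) \<longlonglongrightarrow> (norm (x - p))\<^sup>2"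
    by (intro tendsto_intros p)
  moreover have "(\<lambda>n. d\<^sup>2 + 1 / real (Suc n)) \<longlonglongrightarrow> d\<^sup>2 + 0"
    by (intro tendsto_add tendsto_const LIMSEQ_Suc lim_1_over_n)
  ultimately have "(norm (x - p))\<^sup>2 \<le> d\<^sup>2 + 0"
    by (rule LIMSEQ_le) (auto intro!: exI[of _ 0] less_imp_le r simp del: of_nat_Suc)
  then have "norm (x - p) \<le> d"
    using d0 by (auto intro: power2_le_imp_le)
  then have "norm (x - p) \<le> norm (x - r)" if "r \<in> S" for r
    using d_le[OF that] by linarith
  with that pS show ?thesis
    by blast
qed

lemma orthogonal_projection_exists:
  fixes S :: "'a::chilbert_space set"
  assumes S: "csubspace S" "closed S"
  obtains p where "p \<in> S" "\<And>r. r \<in> S \<Longrightarrow> cinner (x - p) r = 0"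
proof -
  obtain p where p: "p \<in> S" and min: "\<And>r. r \<in> S \<Longrightarrow> norm (x - p) \<le> norm (x - r)"
    using closest_point_csubspace[OF S] by blast
  have "cinner (x - p) r = 0" if r: "r \<in> S" for r
  proof (cases "r = 0")
    case False
    define c where "c = cinner (x - p) r / cinner r r"
    have "p + c *\<^sub>C r \<in> S"
      using S(1) p r by (auto simp: csubspace_def)
    then have "norm (x - p) \<le> norm (x - p - c *\<^sub>C r)"
      using min by (simp add: diff_diff_eq)
    then have "(norm (x - p))\<^sup>2 \<le> (norm (x - p - c *\<^sub>C r))\<^sup>2"
      by (intro power_mono) auto
    then have "(cmod (cinner (x - p) r))\<^sup>2 / (norm r)\<^sup>2 \<le> 0"
      using norm_diff_component[OF False, of "x - p"] by (simp add: c_def)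
    then show ?thesis
      using False by (simp add: divide_le_0_iff)
  qed simp
  with that p show ?thesis
    by blast
qed

lemma bounded_clinear_add: "bounded_clinear f \<Longrightarrow> f (x + y) = f x + f y"
  by (simp add: bounded_clinear_def linear_simps)

lemma bounded_clinear_diff: "bounded_clinear f \<Longrightarrow> f (x - y) = f x - f y"
  by (simp add: bounded_clinear_def linear_simps)

lemma bounded_clinear_zero: "bounded_clinear f \<Longrightarrow> f 0 = 0"
  by (simp add: bounded_clinear_def linear_simps)

lemma bounded_clinear_scaleC: "bounded_clinear f \<Longrightarrow> f (c *\<^sub>C x) = c *\<^sub>C f x"
  by (simp add: bounded_clinear_def)

lemma bounded_clinear_compose:
  "bounded_clinear f \<Longrightarrow> bounded_clinear g \<Longrightarrow> bounded_clinear (f \<circ> g)"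
  using bounded_linear_compose[of f g] by (simp add: bounded_clinear_def o_def)

lemma csubspace_range:
  assumes "bounded_clinear f"
  shows "csubspace (range f)"
proof -
  have "0 \<in> range f"
    using bounded_clinear_zero[OF assms] by (metis rangeI)
  then show ?thesis
    unfolding csubspace_def
    by (auto simp flip: bounded_clinear_add[OF assms] bounded_clinear_scaleC[OF assms])
qed

text \<open>The vectors orthogonal to the kernel of a nonzero functional form a line, and
  a suitable multiple of any nonzero vector on that line represents the functional.\<close>

theorem Riesz_representation:
  fixes f :: "'a::chilbert_space \<Rightarrow> complex"
  assumes f: "bounded_clinear f"
  shows "\<exists>y. \<forall>x. f x = cinner x y"
proof (cases "\<forall>x. f x = 0")
  case True
  then show ?thesis
    by (intro exI[of _ 0]) simp
next
  case False
  then obtain x where x: "f x \<noteq> 0"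
    by blast
  define K where "K = {z. f z = 0}"
  have "csubspace K"
    using f by (auto simp: csubspace_def K_def bounded_clinear_add bounded_clinear_zero
        bounded_clinear_scaleC scaleC_zero_right)
  moreover have "closed K"
  proof -
    have "continuous_on UNIV f"
      using f by (simp add: bounded_clinear_def linear_continuous_on)
    then show ?thesis
      unfolding K_def by (intro closed_Collect_eq) auto
  qed
  ultimately obtain p where p: "p \<in> K" and orth: "\<And>r. r \<in> K \<Longrightarrow> cinner (x - p) r = 0"
    using orthogonal_projection_exists[of K x] by blast
  define q where "q = x - p"
  have fq: "f q \<noteq> 0"
    using x p f by (simp add: q_def bounded_clinear_diff K_def)
  then have qq: "cinner q q \<noteq> 0"
    using cinner_eq_zero_iff bounded_clinear_zero[OF f] by metis
  have "f z = cinner z (cnj (f q / cinner q q) *\<^sub>C q)" for z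
  proof -
    have "z - (f z / f q) *\<^sub>C q \<in> K"
      using fq f
      by (simp add: K_def bounded_clinear_diff bounded_clinear_scaleC scaleC_complex_def)
    then have "cinner (z - (f z / f q) *\<^sub>C q) q = 0"
      using orth cinner_eq_zero_commute by (metis q_def)
    then show ?thesis
      using fq qq by (simp add: cinner_diff_left cinner_scaleC_left cinner_scaleC_right)
  qed
  then show ?thesis
    by blast
qed

section \<open>Uniform boundedness and adjoints\<close>

text \<open>Baire category: the closed sets on which the whole family is bounded by \<open>n\<close> cover the
  space, so one of them contains a ball.\<close>

theorem uniform_boundedness:
  fixes F :: "('a::{real_normed_vector, complete_space} \<Rightarrow> 'b::real_normed_vector) set"
  assumes lin: "\<And>f. f \<in> F \<Longrightarrow> bounded_linear f"
    and pointwise: "\<And>x. \<exists>K. \<forall>f\<in>F. norm (f x) \<le> K"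
  shows "\<exists>K. \<forall>f\<in>F. \<forall>x. norm (f x) \<le> norm x * K"
proof -
  define E where "E n = {x. \<forall>f\<in>F. norm (f x) \<le> real n}" for n :: nat
  have closed_E: "closed (E n)" for n
  proof -
    have "E n = (\<Inter>f\<in>F. {x. norm (f x) \<le> real n})"
      by (auto simp: E_def)
    also have "closed \<dots>"
      using lin by (intro closed_INT ballI closed_Collect_le continuous_on_norm
          continuous_on_const linear_continuous_on)
    finally show ?thesis .
  qed
  have cover: "(\<Union>n. E n) = UNIV"
  proof -
    have "x \<in> (\<Union>n. E n)" for x
    proof -
      obtain K where "\<forall>f\<in>F. norm (f x) \<le> K"
        using pointwise by blast
      moreover obtain n where "K \<le> real n"
        using real_arch_simple by blast
      ultimately have "x \<in> E n"
        by (force simp: E_def)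
      then show ?thesis
        by blast
    qed
    then show ?thesis
      by blast
  qed
  have "\<exists>n. interior (E n) \<noteq> {}"
  proof (rule ccontr)
    assume "\<not> ?thesis"
    then have "Met_TC.mtopology interior_of (\<Union>(range E)) = {}"
      using closed_E
      by (intro Met_TC.metric_Baire_category_alt)
        (auto simp: Met_TC.mcomplete_def Cauchy_convergent_iff convergent_def)
    then show False
      using cover by simp
  qed
  then obtain n x0 r where r: "r > 0" "ball x0 r \<subseteq> E n"
    by (meson equals0I open_contains_ball open_interior interior_subset order_trans)
  have "norm (f x) \<le> norm x * (4 * real n / r)" if f: "f \<in> F" for f x
  proof (cases "x = 0")
    case True
    then show ?thesis
      using lin[OF f] by (simp add: linear_simps)
  next
    case False
    interpret f: bounded_linear f
      by (rule lin[OF f])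
    define z where "z = (r / (2 * norm x)) *\<^sub>R x"
    have "norm z = r / 2"
      using False r by (simp add: z_def)
    then have "x0 + z \<in> E n" "x0 \<in> E n"
      using r by (auto simp: dist_norm)
    then have "norm (f (x0 + z)) \<le> real n" "norm (f x0) \<le> real n"
      using f by (auto simp: E_def)
    moreover have "f z = f (x0 + z) - f x0"
      by (simp add: f.add)
    ultimately have "norm (f z) \<le> 2 * real n"
      using norm_triangle_ineq4[of "f (x0 + z)" "f x0"] by simp
    then have "r / (2 * norm x) * norm (f x) \<le> 2 * real n"
      using r False by (simp add: z_def f.scaleR)
    then show ?thesis
      using r False by (simp add: field_simps)
  qed
  then show ?thesis
    by blast
qed

text \<open>Hellinger-Toeplitz: the functionals \<open>\<lambda>y. cinner y (S x)\<close>, for \<open>x\<close> in the unit ball, are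
  bounded at each \<open>y\<close> by \<open>norm (S' y)\<close>, hence uniformly; evaluating them at \<open>y = S x\<close> bounds
  \<open>S\<close>. Linearity of \<open>S\<close> is also a consequence of the adjoint relation. Boundedness of both
  the adjoint and the Moore-Penrose inverse will come from this result.\<close>

theorem bounded_clinear_if_formal_adjoint:
  fixes S S' :: "'a::chilbert_space \<Rightarrow> 'a"
  assumes adj: "\<And>x y. cinner (S x) y = cinner x (S' y)"
  shows "bounded_clinear S"
proof -
  have add: "S (x + y) = S x + S y" for x y
    by (rule cinner_left_ext) (simp add: adj cinner_add_left)
  have scale: "S (c *\<^sub>C x) = c *\<^sub>C S x" for c x
    by (rule cinner_left_ext) (simp add: adj cinner_scaleC_left)
  define F where "F = {\<lambda>y. cinner y (S x) |x. norm x \<le> 1}"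
  have "\<exists>K. \<forall>f\<in>F. \<forall>y. norm (f y) \<le> norm y * K"
  proof (rule uniform_boundedness)
    show "bounded_linear f" if "f \<in> F" for f
      using that by (auto simp: F_def bounded_linear_cinner_left)
    fix y
    have "cmod (cinner y (S x)) \<le> norm (S' y)" if "norm x \<le> 1" for x
    proof -
      have "cmod (cinner y (S x)) = cmod (cinner x (S' y))"
        by (metis adj cinner_commute complex_mod_cnj)
      also have "\<dots> \<le> norm x * norm (S' y)"
        by (rule cinner_Cauchy_Schwarz)
      also have "\<dots> \<le> norm (S' y)"
        using that by (simp add: mult_left_le_one_le)
      finally show ?thesis .
    qed
    then show "\<exists>K. \<forall>f\<in>F. norm (f y) \<le> K"
      by (auto simp: F_def)
  qed
  then obtain K0 where "\<forall>f\<in>F. \<forall>y. norm (f y) \<le> norm y * K0"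
    by blast
  then have K0: "cmod (cinner y (S x)) \<le> norm y * K0" if "norm x \<le> 1" for x y
    using that by (auto simp: F_def)
  define K where "K = \<bar>K0\<bar>"
  have K: "cmod (cinner y (S x)) \<le> norm y * K" if "norm x \<le> 1" for x y
    using K0[OF that, of y] mult_left_mono[OF abs_ge_self norm_ge_zero, of y K0]
    unfolding K_def by (rule order_trans)
  have unit: "norm (S x) \<le> K" if "norm x \<le> 1" for x
  proof -
    have "norm (S x) * norm (S x) \<le> norm (S x) * K"
      using K[OF that, of "S x"] by (simp add: cinner_self norm_power power2_eq_square norm_mult)
    then show ?thesis
      by (cases "S x = 0") (auto simp: K_def)
  qed
  have scaleR: "S (r *\<^sub>R x) = r *\<^sub>R S x" for r x
    by (simp add: scaleR_scaleC scale)
  have "norm (S x) \<le> norm x * K" for x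
  proof (cases "x = 0")
    case True
    then show ?thesis
      using add[of 0 0] by simp
  next
    case False
    then have "norm (S ((1 / norm x) *\<^sub>R x)) \<le> K"
      by (intro unit) simp
    then show ?thesis
      using False by (simp add: scaleR field_simps)
  qed
  then have "bounded_linear S"
    by (intro bounded_linear_intro[where K = K] add scaleR)
  then show ?thesis
    by (simp add: bounded_clinear_def scale)
qed

lemma cadjoint_eqI:
  fixes T S :: "'a::chilbert_space \<Rightarrow> 'a"
  assumes adj: "\<And>x y. cinner (T x) y = cinner x (S y)"
  shows "cadjoint T = S"
  unfolding cadjoint_def
proof (rule the_equality)
  have "cinner (S x) y = cinner x (T y)" for x y
    by (metis adj cinner_commute)
  then show "bounded_clinear S \<and> (\<forall>x y. cinner (T x) y = cinner x (S y))"
    using adj by (blast intro: bounded_clinear_if_formal_adjoint)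
next
  fix S'
  assume "bounded_clinear S' \<and> (\<forall>x y. cinner (T x) y = cinner x (S' y))"
  then show "S' = S"
    by (metis adj cinner_right_ext ext)
qed

lemma cinner_cadjoint:
  fixes T :: "'a::chilbert_space \<Rightarrow> 'a"
  assumes T: "bounded_clinear T"
  shows "cinner (T x) y = cinner x (cadjoint T y)"
proof -
  have "\<exists>z. \<forall>x. cinner (T x) y = cinner x z" for y
  proof (rule Riesz_representation)
    show "bounded_clinear (\<lambda>x. cinner (T x) y)"
      using bounded_linear_compose[OF bounded_linear_cinner_left, of T y] T
      by (simp add: bounded_clinear_def cinner_scaleC_left scaleC_complex_def)
  qed
  then obtain S where S: "\<And>x y. cinner (T x) y = cinner x (S y)"
    by metis
  show ?thesis
    using cadjoint_eqI[of T S] S by simp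
qed

lemma bounded_clinear_cadjoint:
  fixes T :: "'a::chilbert_space \<Rightarrow> 'a"
  assumes "bounded_clinear T"
  shows "bounded_clinear (cadjoint T)"
  by (rule bounded_clinear_if_formal_adjoint[of _ T])
    (metis assms cinner_cadjoint cinner_commute)

section \<open>The Moore-Penrose inverse of an EP operator\<close>

text \<open>Taking adjoints in \<open>R = PQ\<close> reverses the product. This is how the projections belonging
  to two Moore-Penrose inverses are identified.\<close>

lemma self_adjoint_product_commute:
  fixes P Q R :: "'a::chilbert_space \<Rightarrow> 'a"
  assumes "bounded_clinear P" "bounded_clinear Q" "bounded_clinear R"
    and "P = cadjoint P" "Q = cadjoint Q" "R = cadjoint R" "R = P \<circ> Q"
  shows "R = Q \<circ> P"
proof
  fix x
  have "cinner z (R x) = cinner z ((Q \<circ> P) x)" for z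
    using assms cinner_cadjoint by (metis comp_apply)
  then show "R x = (Q \<circ> P) x"
    by (rule cinner_right_ext)
qed

lemma moore_penrose_eqI:
  fixes T S :: "'a::chilbert_space \<Rightarrow> 'a"
  assumes T: "bounded_clinear T" and S: "bounded_clinear S"
    and TST: "T \<circ> S \<circ> T = T" and STS: "S \<circ> T \<circ> S = S"
    and sa: "T \<circ> S = cadjoint (T \<circ> S)" "S \<circ> T = cadjoint (S \<circ> T)"
  shows "moore_penrose T = S"
  unfolding moore_penrose_def
proof (rule the_equality)
  show "bounded_clinear S \<and> T \<circ> S \<circ> T = T \<and> S \<circ> T \<circ> S = S \<and>
      T \<circ> S = cadjoint (T \<circ> S) \<and> S \<circ> T = cadjoint (S \<circ> T)"
    using assms by blast
next
  fix S'
  assume "bounded_clinear S' \<and> T \<circ> S' \<circ> T = T \<and> S' \<circ> T \<circ> S' = S' \<and>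
      T \<circ> S' = cadjoint (T \<circ> S') \<and> S' \<circ> T = cadjoint (S' \<circ> T)"
  then have S': "bounded_clinear S'" and TS'T: "T \<circ> S' \<circ> T = T" and S'TS': "S' \<circ> T \<circ> S' = S'"
    and sa': "T \<circ> S' = cadjoint (T \<circ> S')" "S' \<circ> T = cadjoint (S' \<circ> T)"
    by auto
  note bounded = bounded_clinear_compose[OF T S] bounded_clinear_compose[OF T S']
    bounded_clinear_compose[OF S T] bounded_clinear_compose[OF S' T]
  have "T \<circ> S = (T \<circ> S') \<circ> (T \<circ> S)"
    by (metis TS'T comp_assoc)
  then have "T \<circ> S = (T \<circ> S) \<circ> (T \<circ> S')"
    by (rule self_adjoint_product_commute[OF bounded(2,1,1) sa'(1) sa(1) sa(1)])
  also have "\<dots> = T \<circ> S'"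
    by (metis TST comp_assoc)
  finally have TS: "T \<circ> S = T \<circ> S'" .
  have "S \<circ> T = (S \<circ> T) \<circ> (S' \<circ> T)"
    by (metis TS'T comp_assoc)
  then have "S \<circ> T = (S' \<circ> T) \<circ> (S \<circ> T)"
    by (rule self_adjoint_product_commute[OF bounded(3,4,3) sa(2) sa'(2) sa(2)])
  also have "\<dots> = S' \<circ> T"
    by (metis TST comp_assoc)
  finally have "S \<circ> T = S' \<circ> T" .
  with TS show "S' = S"
    by (metis STS S'TS' comp_assoc)
qed

text \<open>The value \<open>V x\<close> is a preimage in \<open>range U\<close> of the orthogonal projection of \<open>x\<close> onto
  \<open>range U\<close>. An arbitrary preimage can be moved into \<open>range U\<close> by projecting it there,
  since \<open>U\<close> does not see the orthogonal complement.\<close>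

lemma partial_inverse_on_range:
  fixes U :: "'a::chilbert_space \<Rightarrow> 'a"
  assumes U: "bounded_clinear U" "closed (range U)"
    and kills: "\<And>q. (\<And>r. r \<in> range U \<Longrightarrow> cinner q r = 0) \<Longrightarrow> U q = 0"
  shows "\<exists>V. \<forall>x. V x \<in> range U \<and> (\<forall>r\<in>range U. cinner (x - U (V x)) r = 0)"
proof -
  note proj = orthogonal_projection_exists[OF csubspace_range[OF U(1)] U(2)]
  have "\<exists>v. v \<in> range U \<and> (\<forall>r\<in>range U. cinner (x - U v) r = 0)" for x
  proof -
    obtain p where p: "p \<in> range U" "\<And>r. r \<in> range U \<Longrightarrow> cinner (x - p) r = 0"
      using proj by blast
    obtain z where z: "p = U z"
      using p(1) by blast
    obtain v where v: "v \<in> range U" "\<And>r. r \<in> range U \<Longrightarrow> cinner (z - v) r = 0"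
      using proj by blast
    have "U (z - v) = 0"
      using v(2) by (rule kills)
    then have "U v = p"
      using U(1) z by (simp add: bounded_clinear_diff)
    then show ?thesis
      using v(1) p(2) by blast
  qed
  then show ?thesis
    by metis
qed

theorem moore_penrose_EP_operator:
  fixes T :: "'a::chilbert_space \<Rightarrow> 'a"
  assumes "EP_operator T"
  shows "T \<circ> moore_penrose T \<circ> T = T"
    and "moore_penrose T \<circ> T \<circ> moore_penrose T = moore_penrose T"
    and "T \<circ> moore_penrose T = moore_penrose T \<circ> T"
proof -
  define T' where "T' = cadjoint T"
  define R where "R = range T"
  have T: "bounded_clinear T" and closed: "closed R" and R': "range T' = R"
    using assms by (auto simp: EP_operator_def T'_def R_def)
  have T': "bounded_clinear T'"
    unfolding T'_def by (rule bounded_clinear_cadjoint[OF T])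
  have adj: "cinner (T x) y = cinner x (T' y)" for x y
    unfolding T'_def by (rule cinner_cadjoint[OF T])
  have sub: "x - y \<in> R" if "x \<in> R" "y \<in> R" for x y
    using csubspace_diff[OF csubspace_range[OF T]] that by (simp add: R_def)
  have TR: "T x \<in> R" and T'R: "T' x \<in> R" for x
    using R' by (auto simp: R_def)
  have self_orth: "x = 0" if "x \<in> R" "\<And>r. r \<in> R \<Longrightarrow> cinner x r = 0" for x
    using that cinner_eq_zero_iff by blast
  have T_perp: "T q = 0" if "\<And>r. r \<in> R \<Longrightarrow> cinner q r = 0" for q
    using that[OF T'R[of "T q"]] adj[of q "T q"] cinner_eq_zero_iff[of "T q"] by simp
  have T'_perp: "T' q = 0" if "\<And>r. r \<in> R \<Longrightarrow> cinner q r = 0" for q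
  proof -
    have "cinner (T (T' q)) q = 0"
      using that[OF TR] cinner_eq_zero_commute by blast
    then show ?thesis
      using adj[of "T' q" q] cinner_eq_zero_iff[of "T' q"] by simp
  qed
  have inj: "r = 0" if "r \<in> R" "T r = 0" for r
  proof -
    obtain s where "r = T' s"
      using R' \<open>r \<in> R\<close> by blast
    then show ?thesis
      using adj[of r s] \<open>T r = 0\<close> cinner_eq_zero_iff[of r] by simp
  qed
  obtain S where SR: "\<And>x. S x \<in> R" and S: "\<And>x r. r \<in> R \<Longrightarrow> cinner (x - T (S x)) r = 0"
    using partial_inverse_on_range[OF T] closed T_perp unfolding R_def by metis
  obtain S' where S'R: "\<And>x. S' x \<in> R" and S': "\<And>x r. r \<in> R \<Longrightarrow> cinner (x - T' (S' x)) r = 0"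
    using partial_inverse_on_range[OF T'] closed T'_perp unfolding R' by metis
  have "cinner (S x) y = cinner x (S' y)" for x y
  proof -
    \<comment> \<open>Both sides only see the components of \<open>x\<close> and \<open>y\<close> in \<open>R\<close>, where \<open>TS\<close> and \<open>T'S'\<close> act
      as the identity.\<close>
    have "cinner (S x) (y - T' (S' y)) = 0"
      using S'[OF SR] cinner_eq_zero_commute by blast
    then have "cinner (S x) y = cinner (T (S x)) (S' y)"
      by (simp add: cinner_diff_right adj)
    also have "\<dots> = cinner x (S' y)"
      using S[OF S'R, of x y] by (simp add: cinner_diff_left)
    finally show ?thesis .
  qed
  then have bS: "bounded_clinear S"
    by (rule bounded_clinear_if_formal_adjoint)
  have TS_id: "T (S x) = x" if "x \<in> R" for x
    using self_orth[OF sub[OF that TR] S] by simp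
  have comm: "T (S x) = S (T x)" for x
  proof -
    have "T (x - T (S x)) = 0"
      using S by (rule T_perp)
    then have "T (T (S x) - S (T x)) = 0"
      by (simp add: bounded_clinear_diff[OF T] TS_id[OF TR])
    then show ?thesis
      using inj[OF sub[OF TR SR]] by simp
  qed
  have TST: "T \<circ> S \<circ> T = T"
    by (auto simp: TS_id TR)
  have STS: "S \<circ> T \<circ> S = S"
    by (auto simp: comm[symmetric] TS_id SR)
  have TS: "T \<circ> S = S \<circ> T"
    by (auto simp: comm)
  have "cinner ((T \<circ> S) x) y = cinner x ((T \<circ> S) y)" for x y
  proof -
    have "cinner (T (S x)) (y - T (S y)) = 0"
      using S[OF TR] cinner_eq_zero_commute by blast
    then have "cinner (T (S x)) y = cinner (T (S x)) (T (S y))"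
      by (simp add: cinner_diff_right)
    then show ?thesis
      using S[OF TR[of "S y"], of x] by (simp add: cinner_diff_left)
  qed
  then have "cadjoint (T \<circ> S) = T \<circ> S"
    by (rule cadjoint_eqI)
  then have "moore_penrose T = S"
    by (intro moore_penrose_eqI T bS TST STS) (simp_all flip: TS)
  then show "T \<circ> moore_penrose T \<circ> T = T"
    and "moore_penrose T \<circ> T \<circ> moore_penrose T = moore_penrose T"
    and "T \<circ> moore_penrose T = moore_penrose T \<circ> T"
    using TST STS TS by simp_all
qed

section \<open>Commutation\<close>

text \<open>A commuting generalized inverse satisfies \<open>S = TSS = SST\<close> and \<open>T = STT = TTS\<close>. With these,
  \<open>AS = ATSS = TASS = STTASS = STATSS = STAS\<close> and \<open>SA = SSTA = SSAT = SSATTS = SSTTAS = STAS\<close>.\<close>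

lemma commutes_with_group_inverse:
  fixes T S A :: "'a \<Rightarrow> 'a"
  assumes TST: "T \<circ> S \<circ> T = T" and STS: "S \<circ> T \<circ> S = S" and TS: "T \<circ> S = S \<circ> T"
    and AT: "A \<circ> T = T \<circ> A"
  shows "A \<circ> S = S \<circ> A"
proof -
  have tst: "T (S (T x)) = T x" and sts: "S (T (S x)) = S x"
    and ts: "T (S x) = S (T x)" and at: "A (T x) = T (A x)" for x
    using assms by (auto simp: fun_eq_iff)
  have "A (S x) = S (T (A (S x)))" for x
  proof -
    have S: "S x = T (S (S x))"
      using sts ts by metis
    have "A (S x) = T (A (S (S x)))"
      using S at by metis
    also have "\<dots> = S (T (T (A (S (S x)))))"
      using tst ts by metis
    also have "\<dots> = S (T (A (S x)))"
      using S at by metis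
    finally show ?thesis .
  qed
  moreover have "S (A x) = S (T (A (S x)))" for x
  proof -
    have "S (A x) = S (S (T (A x)))"
      using sts ts by metis
    also have "\<dots> = S (S (A (T (T (S x)))))"
      using tst ts at by metis
    also have "\<dots> = S (S (T (T (A (S x)))))"
      using at by metis
    also have "\<dots> = S (T (A (S x)))"
      using sts ts by metis
    finally show ?thesis .
  qed
  ultimately show ?thesis
    by (auto simp: fun_eq_iff)
qed

theorem theorem3p3:
  fixes T A :: "'a::chilbert_space \<Rightarrow> 'a"
  assumes "EP_operator T"
    and "bounded_clinear A"
    and "A \<circ> T = T \<circ> A"
  shows "A \<circ> moore_penrose T = moore_penrose T \<circ> A"
  by (rule commutes_with_group_inverse[OF moore_penrose_EP_operator[OF assms(1)] assms(3)])

end
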